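(* Let $\mu=\sum_{i=1}^n\lambda_i\,\delta(x_i,y_i)$ be a finitely atomic probability measure on $\mathbb{R}^2$, and let $k\ge 1$ be an integer. Then a polynomial $p\in\mathbb{R}_k[x,y]$ is a recursive relation for $M(\mu)(k)$ if and only if $\hat p\in\ker\big(V(\mu)(k)\big)$.
   Context: $\delta(a,b)$ denotes the point-mass probability measure supported at $(a,b)\in\mathbb{R}^2$. A finitely atomic probability measure is a measure $\mu=\sum_{i=1}^n\lambda_i\delta(x_i,y_i)$ with $n\ge 1$, distinct atoms $(x_i,y_i)\in\mathbb{R}^2$, real densities $\lambda_i>0$, and $\sum_i\lambda_i=1$. $\mathbb{R}_k[x,y]$ is the space of real polynomials in $x,y$ of total degree at most $k$. Its monomials are listed in the order $1,x,y,x^2,xy,y^2,x^3,\dots,xy^{k-1},y^k$. For $p=\sum_{i+j\le k}a_{ij}x^iy^j$, $\hat p=(a_{ij})$ denotes the coefficient (column) vector of $p$ with respect to this ordered monomial basis. The moment matrix $M(\mu)(k)$ is the square matrix with rows and columns indexed by these monomials, whose entry in row $x^ay^b$ and column $x^cy^d$ is $\int x^{a+c}y^{b+d}\,d\mu$. A polynomial $p\in\mathbb{R}_k[x,y]$ is a recursive relation for $M(\mu)(k)$ if $M(\mu)(k)\cdot\hat p=\boldsymbol 0$. The 2-variable Vandermonde-like matrix $V(\mu)(k)$ is the matrix with $n$ rows and with columns indexed by the same monomials, whose $i$-th row is $(1,x_i,y_i,x_i^2,x_iy_i,y_i^2,\dots,x_iy_i^{k-1},y_i^k)$, i.e. the entry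 in row $i$ and column $x^cy^d$ is $x_i^cy_i^d$. *)

theory Defs
  imports "HOL-Probability.Probability" "Jordan_Normal_Form.Matrix_Kernel"
begin

abbreviation point_mass :: "real \<Rightarrow> real \<Rightarrow> (real \<times> real) measure" where
  "point_mass a b \<equiv> return borel (a, b)"

definition atomic_measure ::
  "nat \<Rightarrow> (nat \<Rightarrow> real) \<Rightarrow> (nat \<Rightarrow> real) \<Rightarrow> (nat \<Rightarrow> real) \<Rightarrow> (real \<times> real) measure" where
  "atomic_measure n lam x y =
     measure_of UNIV (sets borel) (\<lambda>A. \<Sum>i<n. ennreal (lam i) * emeasure (point_mass (x i) (y i)) A)"

text \<open>\<^const>\<open>measure_of\<close> yields the zero measure if its argument is not
  countably additive. The next two facts show that this does not happen here.\<close>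

lemma sets_atomic_measure [simp, measurable_cong]: "sets (atomic_measure n lam x y) = sets borel"
  unfolding atomic_measure_def
  by (rule sets.sets_measure_of_eq[of borel, unfolded space_borel])

lemma emeasure_atomic_measure:
  assumes "A \<in> sets borel"
  shows "emeasure (atomic_measure n lam x y) A =
    (\<Sum>i<n. ennreal (lam i) * emeasure (point_mass (x i) (y i)) A)"
proof (rule emeasure_measure_of[OF atomic_measure_def])
  let ?f = "\<lambda>A. \<Sum>i<n. ennreal (lam i) * emeasure (point_mass (x i) (y i)) A"
  show "positive (sets (atomic_measure n lam x y)) ?f"
    by (simp add: positive_def)
  show "countably_additive (sets (atomic_measure n lam x y)) ?f"
  proof (rule countably_additiveI)
    fix B :: "nat \<Rightarrow> (real \<times> real) set"
    assume B: "range B \<subseteq> sets (atomic_measure n lam x y)" "disjoint_family B"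
    have "(\<Sum>j. ?f (B j)) = (\<Sum>i<n. \<Sum>j. ennreal (lam i) * emeasure (point_mass (x i) (y i)) (B j))"
      by (rule suminf_sum) simp
    also have "\<dots> = ?f (\<Union> (range B))"
    proof (rule sum.cong[OF refl])
      fix i
      have "(\<Sum>j. emeasure (point_mass (x i) (y i)) (B j)) = emeasure (point_mass (x i) (y i)) (\<Union> (range B))"
        using B by (intro suminf_emeasure) auto
      then show "(\<Sum>j. ennreal (lam i) * emeasure (point_mass (x i) (y i)) (B j)) =
          ennreal (lam i) * emeasure (point_mass (x i) (y i)) (\<Union> (range B))"
        by simp
    qed
    finally show "(\<Sum>j. ?f (B j)) = ?f (\<Union> (range B))" .
  qed
qed (use assms in auto)

text \<open>The pair \<open>(i, j)\<close> stands for the monomial \<open>x ^ i * y ^ j\<close>; within each degree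
  the exponent of \<open>y\<close> increases.\<close>

definition monomials :: "nat \<Rightarrow> (nat \<times> nat) list" where
  "monomials k = concat (map (\<lambda>d. map (\<lambda>j. (d - j, j)) [0..<Suc d]) [0..<Suc k])"

lemma "monomials 3 = [(0,0), (1,0),(0,1), (2,0),(1,1),(0,2), (3,0),(2,1),(1,2),(0,3)]"
  by (simp add: monomials_def upt_conv_Cons)

text \<open>\<^typ>\<open>real poly poly\<close> is read as the ring of polynomials in \<open>y\<close> whose coefficients are
  polynomials in \<open>x\<close>.\<close>

definition coeff2 :: "real poly poly \<Rightarrow> nat \<Rightarrow> nat \<Rightarrow> real" where
  "coeff2 p i j = coeff (coeff p j) i"

definition polys_upto :: "nat \<Rightarrow> real poly poly set" where
  "polys_upto k = {p. \<forall>i j. coeff2 p i j \<noteq> 0 \<longrightarrow> i + j \<le> k}"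

definition coeff_vec :: "nat \<Rightarrow> real poly poly \<Rightarrow> real Matrix.vec" where
  "coeff_vec k p = vec_of_list (map (\<lambda>(i, j). coeff2 p i j) (monomials k))"

definition moment_matrix :: "(real \<times> real) measure \<Rightarrow> nat \<Rightarrow> real mat" where
  "moment_matrix \<mu> k =
     mat (length (monomials k)) (length (monomials k)) (\<lambda>(r, s).
       case (monomials k ! r, monomials k ! s) of ((a, b), (c, d)) \<Rightarrow>
         \<integral>z. fst z ^ (a + c) * snd z ^ (b + d) \<partial>\<mu>)"

definition vandermonde_matrix ::
  "nat \<Rightarrow> (nat \<Rightarrow> real) \<Rightarrow> (nat \<Rightarrow> real) \<Rightarrow> nat \<Rightarrow> real mat" where
  "vandermonde_matrix n x y k =
     mat n (length (monomials k)) (\<lambda>(i, s).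
       case monomials k ! s of (c, d) \<Rightarrow> x i ^ c * y i ^ d)"

definition recursive_relation :: "(real \<times> real) measure \<Rightarrow> nat \<Rightarrow> real poly poly \<Rightarrow> bool" where
  "recursive_relation \<mu> k p \<longleftrightarrow>
     p \<in> polys_upto k \<and>
     moment_matrix \<mu> k *\<^sub>v coeff_vec k p = 0\<^sub>v (length (monomials k))"

end

theory Submission imports Defs begin

text \<open>The moment matrix factors as the transpose of the Vandermonde matrix \<open>V\<close>, times the diagonal
  matrix of the densities, times \<open>V\<close>. Its quadratic form at a vector \<open>v\<close> is therefore the sum of
  the squares of the entries of \<open>V v\<close> weighted by the positive densities, which vanishes only if
  \<open>V v = 0\<close>.\<close>

text \<open>As a pushforward of a weighted counting measure on the indices, the measure inherits the
  known integration rules for \<open>distr\<close> and \<open>point_measure\<close>.\<close>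

lemma atomic_measure_eq_distr:
  assumes "\<And>i. i < n \<Longrightarrow> lam i > 0"
  shows "atomic_measure n lam x y =
    distr (point_measure {..<n} (\<lambda>i. ennreal (lam i))) borel (\<lambda>i. (x i, y i))"
proof (rule measure_eqI)
  fix A :: "(real \<times> real) set"
  assume "A \<in> sets (atomic_measure n lam x y)"
  then have A: "A \<in> sets borel" by simp
  let ?B = "(\<lambda>i. (x i, y i)) -` A \<inter> {..<n}"
  have "emeasure (distr (point_measure {..<n} (\<lambda>i. ennreal (lam i))) borel (\<lambda>i. (x i, y i))) A
      = (\<Sum>i\<in>?B. ennreal (lam i))"
    using A by (subst emeasure_distr)
      (auto simp: measurable_point_measure_eq1 space_point_measure emeasure_point_measure_finite)
  \<comment> \<open>Atoms outside \<open>A\<close> have point mass 0 on \<open>A\<close>, so the sum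
    may run over all indices.\<close>
  also have "\<dots> = (\<Sum>i<n. ennreal (lam i) * emeasure (point_mass (x i) (y i)) A)"
    using A by (intro sum.mono_neutral_cong_left) (auto simp: indicator_def)
  finally show "emeasure (atomic_measure n lam x y) A = emeasure
      (distr (point_measure {..<n} (\<lambda>i. ennreal (lam i))) borel (\<lambda>i. (x i, y i))) A"
    using A by (simp add: emeasure_atomic_measure)
qed simp

lemma integral_atomic_measure:
  fixes f :: "real \<times> real \<Rightarrow> real"
  assumes "\<And>i. i < n \<Longrightarrow> lam i > 0" and "f \<in> borel_measurable borel"
  shows "(\<integral>z. f z \<partial>atomic_measure n lam x y) = (\<Sum>i<n. lam i * f (x i, y i))"
proof -
  have "(\<integral>z. f z \<partial>atomic_measure n lam x y) =
      (\<integral>i. f (x i, y i) \<partial>point_measure {..<n} (\<lambda>i. ennreal (lam i)))"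
    using assms by (simp add: atomic_measure_eq_distr integral_distr measurable_point_measure_eq1)
  also have "\<dots> = (\<Sum>i<n. lam i * f (x i, y i))"
    \<comment> \<open>Since \<open>ennreal\<close> sends negative reals to 0, the sign of
      \<open>lam i\<close> is what lets it return as a real factor.\<close>
    using assms(1) by (subst lebesgue_integral_point_measure_finite) (auto simp: less_imp_le)
  finally show ?thesis .
qed

text \<open>Pairing the system on the left with \<open>v\<close> itself turns it into a weighted sum
  of squares. Plain sums over index sets reduce the matrix algebra to swaps of summation.\<close>

lemma weighted_gram_kernel:
  fixes lam :: "'i \<Rightarrow> real" and V :: "'i \<Rightarrow> 'j \<Rightarrow> real"
  assumes "finite I" and lam: "\<And>i. i \<in> I \<Longrightarrow> lam i > 0"
  shows "(\<forall>r\<in>J. (\<Sum>s\<in>J. (\<Sum>i\<in>I. lam i * (V i r * V i s)) * v s) = 0) \<longleftrightarrow>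
    (\<forall>i\<in>I. (\<Sum>s\<in>J. V i s * v s) = 0)"
proof -
  define w where "w i = (\<Sum>s\<in>J. V i s * v s)" for i
  have gram: "(\<Sum>s\<in>J. (\<Sum>i\<in>I. lam i * (V i r * V i s)) * v s) = (\<Sum>i\<in>I. lam i * V i r * w i)" for r
    unfolding w_def sum_distrib_left sum_distrib_right
    by (subst sum.swap) (simp add: mult_ac)
  have quad: "(\<Sum>r\<in>J. v r * (\<Sum>i\<in>I. lam i * V i r * w i)) = (\<Sum>i\<in>I. lam i * (w i)\<^sup>2)"
  proof -
    have "(\<Sum>r\<in>J. v r * (\<Sum>i\<in>I. lam i * V i r * w i)) = (\<Sum>i\<in>I. \<Sum>r\<in>J. lam i * w i * (V i r * v r))"
      unfolding sum_distrib_left by (subst sum.swap) (simp add: mult_ac)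
    also have "\<dots> = (\<Sum>i\<in>I. lam i * (w i)\<^sup>2)"
      unfolding sum_distrib_left[symmetric] w_def[symmetric] by (simp add: power2_eq_square mult_ac)
    finally show ?thesis .
  qed
  have "w i = 0" if "\<forall>r\<in>J. (\<Sum>i\<in>I. lam i * V i r * w i) = 0" "i \<in> I" for i
  proof -
    have "(\<Sum>i\<in>I. lam i * (w i)\<^sup>2) = 0"
      using that(1) by (simp flip: quad)
    then have "lam i * (w i)\<^sup>2 = 0"
      using that(2) \<open>finite I\<close> lam
      by (subst (asm) sum_nonneg_eq_0_iff) (auto simp: less_imp_le)
    then show ?thesis using lam[OF that(2)] by simp
  qed
  \<comment> \<open>The converse needs no positivity: by \<open>gram\<close> each left-hand sum is a
    linear combination of the \<open>w i\<close>.\<close>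
  then show ?thesis
    unfolding gram w_def[symmetric] by auto
qed

text \<open>At each atom the monomial with added exponents is the product of the row monomial and
  the column monomial, and both values are entries of the Vandermonde matrix.\<close>

lemma moment_matrix_atomic_measure:
  assumes "\<And>i. i < n \<Longrightarrow> lam i > 0"
  shows "moment_matrix (atomic_measure n lam x y) k =
    mat (length (monomials k)) (length (monomials k)) (\<lambda>(r, s).
      \<Sum>i<n. lam i * (vandermonde_matrix n x y k $$ (i, r) * vandermonde_matrix n x y k $$ (i, s)))"
proof -
  have moment: "(\<integral>z. fst z ^ a * snd z ^ b \<partial>atomic_measure n lam x y) =
      (\<Sum>i<n. lam i * (x i ^ a * y i ^ b))" for a b
    using assms
    by (subst integral_atomic_measure)
      (auto intro!: borel_measurable_continuous_onI continuous_intros)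
  then show ?thesis
    unfolding moment_matrix_def
    by (intro cong_mat; simp add: vandermonde_matrix_def moment split: prod.split)
      (simp add: power_add mult_ac)
qed

text \<open>Applied to both matrices, this brings their kernel equations into the form used in
  \<open>weighted_gram_kernel\<close>.\<close>

lemma mat_mult_vec_eq_0_iff:
  assumes "dim_vec v = c"
  shows "mat r c f *\<^sub>v v = 0\<^sub>v r \<longleftrightarrow>
    (\<forall>i\<in>{..<r}. (\<Sum>j<c. f (i, j) * vec_index v j) = 0)"
  using assms by (auto simp: Matrix.vec_eq_iff scalar_prod_def atLeast0LessThan)

theorem theorem3p4:
  fixes \<mu> :: "(real \<times> real) measure"
    and lam x y :: "nat \<Rightarrow> real"
    and n k :: nat
    and p :: "real poly poly"
  assumes "n \<ge> 1"
    and "inj_on (\<lambda>i. (x i, y i)) {..<n}"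
    and "\<And>i. i < n \<Longrightarrow> lam i > 0"
    and "(\<Sum>i<n. lam i) = 1"
    and "\<mu> = atomic_measure n lam x y"
    and "k \<ge> 1"
    and "p \<in> polys_upto k"
  shows "recursive_relation \<mu> k p \<longleftrightarrow>
    coeff_vec k p \<in> mat_kernel (vandermonde_matrix n x y k)"
proof -
  let ?N = "length (monomials k)"
  let ?V = "vandermonde_matrix n x y k"
  let ?v = "coeff_vec k p"
  have v: "dim_vec ?v = ?N"
    by (simp add: coeff_vec_def)
  \<comment> \<open>Rebuilding \<open>?V\<close> from its entries gives it the shape
    \<open>mat r c f\<close> that \<open>mat_mult_vec_eq_0_iff\<close> expects.\<close>
  have V: "mat n ?N (\<lambda>(i, s). ?V $$ (i, s)) = ?V"
    by (rule eq_matI) (simp_all add: vandermonde_matrix_def)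
  have "recursive_relation \<mu> k p \<longleftrightarrow>
      (\<forall>r\<in>{..<?N}. (\<Sum>s<?N. (\<Sum>i<n. lam i * (?V $$ (i, r) * ?V $$ (i, s))) * vec_index ?v s) = 0)"
    unfolding recursive_relation_def assms(5)
    by (simp add: assms moment_matrix_atomic_measure mat_mult_vec_eq_0_iff[OF v])
  also have "\<dots> \<longleftrightarrow> (\<forall>i\<in>{..<n}. (\<Sum>s<?N. ?V $$ (i, s) * vec_index ?v s) = 0)"
    using assms(3) by (intro weighted_gram_kernel) auto
  also have "\<dots> \<longleftrightarrow> ?V *\<^sub>v ?v = 0\<^sub>v n"
    using mat_mult_vec_eq_0_iff[OF v, of n "\<lambda>(i, s). ?V $$ (i, s)"] unfolding V by simp
  \<comment> \<open>Membership in \<open>mat_kernel\<close> also asks for the right dimension, which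
    is the fact \<open>v\<close>.\<close>
  also have "\<dots> \<longleftrightarrow> ?v \<in> mat_kernel ?V"
    unfolding mat_kernel_def carrier_vec_def by (simp add: v vandermonde_matrix_def)
  finally show ?thesis .
qed

end
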